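(* Let $l$ be a positive integer and let $C_l(n)=\frac{1}{(n+1)^l}\cdot\frac{((l+1)n)!}{(n!)^{l+1}}$ for integers $n\geq 1$. There are at most finitely many integers $n\geq 1$ such that $C_l(n)$ is not an integer. Moreover, every such $n$ is of the form $n=p^j-1$ for some prime $p$ and integer $j\geq 1$ with $p^j\leq l$ and such that $l\neq ap^{kj}-1$ for every integer $k\geq 1$ and every $a\in\{1,2,\ldots,p-1\}$. *)

theory Defs
  imports Complex_Main "HOL-Computational_Algebra.Primes"
begin

definition C :: "nat \<Rightarrow> nat \<Rightarrow> rat" where
  "C l n = 1 / (of_nat n + 1) ^ l * (fact ((l + 1) * n) / fact n ^ (l + 1))"

end

theory Submission imports Defs begin

text \<open>
  By Legendre's formula, the exponent of a prime \<open>p\<close> in \<open>((l+1)n)! / n!^(l+1)\<close> is the sum over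
  \<open>i \<ge> 1\<close> of \<open>T i = ((l+1) (n mod p^i)) div p^i\<close>. If \<open>p^j\<close> is the exact power of \<open>p\<close> dividing
  \<open>n + 1\<close>, then \<open>T i = l - l div p^i\<close> for \<open>i \<le> j\<close>, so \<open>C l n\<close> is \<open>p\<close>-integral once the later
  terms \<open>T i\<close>, \<open>i > j\<close>, compensate for the deficit \<open>\<Sum>i=1..j. l div p^i\<close>.
  If \<open>p^j \<le> n\<close>, choose \<open>p^e \<le> n < p^(e+1)\<close>; then \<open>T (e+s) \<ge> l div p^s\<close> for \<open>s \<ge> 1\<close>.
  Otherwise \<open>n = p^j - 1\<close>. If moreover \<open>l < p^j\<close>, then \<open>T (j+s) = l div p^s\<close>; and if
  \<open>l + 1 = a p^(kj)\<close> with \<open>0 < a < p\<close>, the later terms telescope and equal the deficit.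
\<close>

section \<open>Legendre's formula for factorials\<close>

lemma multiplicity_eq_card_powers_dvd:
  fixes p n N :: nat
  assumes p: "p \<ge> 2" and n: "0 < n" "n \<le> N"
  shows "multiplicity p n = card {i \<in> {1..N}. p ^ i dvd n}"
proof -
  have fin: "n \<noteq> 0" "\<not> is_unit p" using assms by auto
  have "multiplicity p n \<le> N"
  proof -
    have "multiplicity p n < p ^ multiplicity p n"
      using p by (intro power_gt_expt) auto
    also have "\<dots> \<le> n"
      using n by (intro dvd_imp_le multiplicity_dvd) auto
    finally show ?thesis using n by simp
  qed
  then have "{i \<in> {1..N}. p ^ i dvd n} = {1..multiplicity p n}"
    unfolding power_dvd_iff_le_multiplicity[OF fin] by auto
  then show ?thesis by simp
qed

lemma Suc_div_eq_add_indicator: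
  fixes q n :: nat
  assumes "q > 0"
  shows "Suc n div q = n div q + (if q dvd Suc n then 1 else 0)"
  using assms by (auto simp: div_Suc dvd_eq_mod_eq_0)

text \<open>Induction on \<open>n\<close>: passing to \<open>Suc n\<close> adds 1 to the quotient by
  \<open>p ^ i\<close> exactly when \<open>p ^ i\<close> divides \<open>Suc n\<close>. The cutoff
  \<open>N\<close> is free so that sums for different factorials can share one range.\<close>

lemma multiplicity_fact:
  fixes p n N :: nat
  assumes p: "prime p" and "n \<le> N"
  shows "multiplicity p (fact n) = (\<Sum>i=1..N. n div p ^ i)"
  using \<open>n \<le> N\<close>
proof (induction n)
  case 0
  then show ?case by simp
next
  case (Suc n)
  have "multiplicity p (fact (Suc n) :: nat) = multiplicity p (Suc n * fact n)"
    by (simp add: fact_Suc)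
  also have "\<dots> = multiplicity p (Suc n) + multiplicity p (fact n :: nat)"
    using p by (intro prime_elem_multiplicity_mult_distrib) auto
  also have "multiplicity p (Suc n) = card {i \<in> {1..N}. p ^ i dvd Suc n}"
    using Suc.prems p by (intro multiplicity_eq_card_powers_dvd) (auto simp: prime_ge_2_nat)
  also have "\<dots> = (\<Sum>i=1..N. if p ^ i dvd Suc n then 1 else 0)"
    by (simp add: sum.If_cases Int_def)
  also have "multiplicity p (fact n) = (\<Sum>i=1..N. n div p ^ i)"
    using Suc by simp
  finally show ?case
    using p by (simp add: Suc_div_eq_add_indicator prime_gt_0_nat sum.distrib)
qed

lemma mult_div_eq_div_add_mod:
  fixes L n q :: nat
  assumes "q > 0"
  shows "(L * n) div q = L * (n div q) + (L * (n mod q)) div q"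
proof -
  have "L * n = L * (n mod q) + (L * (n div q)) * q"
    by (metis add.commute mult.assoc distrib_left div_mult_mod_eq)
  then show ?thesis using assms by simp
qed

text \<open>Splitting \<open>n\<close> into quotient and remainder modulo \<open>p ^ i\<close>, the
  quotients reproduce \<open>L\<close> copies of Legendre's sum for \<open>n\<close> and the
  remainders leave the excess. For \<open>L = l + 1\<close> this excess is the sum of the
  \<open>T i\<close>.\<close>

lemma multiplicity_fact_mult:
  fixes p n L N :: nat
  assumes p: "prime p" and "n \<le> N" "L * n \<le> N"
  shows "multiplicity p (fact (L * n)) =
    L * multiplicity p (fact n) + (\<Sum>i=1..N. (L * (n mod p ^ i)) div p ^ i)"
proof -
  have "multiplicity p (fact (L * n)) = (\<Sum>i=1..N. L * (n div p ^ i) + (L * (n mod p ^ i)) div p ^ i)"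
    using assms by (subst multiplicity_fact[where N = N])
      (auto intro!: sum.cong mult_div_eq_div_add_mod simp: prime_gt_0_nat)
  also have "\<dots> = L * (\<Sum>i=1..N. n div p ^ i) + (\<Sum>i=1..N. (L * (n mod p ^ i)) div p ^ i)"
    by (simp add: sum.distrib sum_distrib_left)
  finally show ?thesis using assms by (simp add: multiplicity_fact[where N = N])
qed

section \<open>Terms at powers dividing n + 1\<close>

lemma add_mult_div_eq:
  fixes r c q :: nat
  assumes "r < q"
  shows "(r + c * q) div q = c"
  using assms by simp

lemma Suc_mult_pred_div:
  fixes l q :: nat
  assumes "q > 0"
  shows "((l + 1) * (q - 1)) div q + l div q = l"
proof -
  \<comment> \<open>\<open>c\<close> stands for \<open>l - l div q\<close>. It is the desired
    quotient, the remainder being \<open>q - 1 - l mod q\<close>.\<close>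
  obtain c where c: "l = l div q + c"
    using le_Suc_ex[OF div_le_dividend] by blast
  have "l mod q < q" using assms by simp
  have "l * q = (l div q) * q + c * q"
    by (metis c distrib_right)
  moreover have "l = (l div q) * q + l mod q" by simp
  moreover have "(l + 1) * (q - 1) + (l + 1) = l * q + q"
    using assms by (metis Suc_eq_plus1 Suc_pred' add.commute mult.commute mult_Suc mult_Suc_right)
  ultimately have "(l + 1) * (q - 1) = (q - 1 - l mod q) + c * q"
    using \<open>l mod q < q\<close> by linarith
  then have "((l + 1) * (q - 1)) div q = c"
    using assms by simp
  then show ?thesis using c by simp
qed

lemma mod_eq_pred_if_dvd_Suc:
  fixes q n :: nat
  assumes "q dvd n + 1"
  shows "n mod q = q - 1"
  using assms by (metis Suc_eq_plus1 diff_Suc_1 dvd_eq_mod_eq_0 mod_Suc nat.simps(3))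

text \<open>If \<open>p ^ j\<close> is the exact power of \<open>p\<close> in \<open>n + 1\<close>,
  then \<open>(n + 1) ^ l\<close> demands the exponent \<open>l * j\<close>. Each of the first
  \<open>j\<close> terms falls short of \<open>l\<close> by \<open>l div p ^ i\<close>, and
  \<open>le\<close> says that the later terms make up for this.\<close>

lemma mult_le_sum_carries:
  fixes p j l n N :: nat
  assumes p: "p > 0" and dvd: "p ^ j dvd n + 1" and "j \<le> N"
    and le: "(\<Sum>i=1..j. l div p ^ i) \<le> (\<Sum>i=j+1..N. ((l + 1) * (n mod p ^ i)) div p ^ i)"
  shows "l * j \<le> (\<Sum>i=1..N. ((l + 1) * (n mod p ^ i)) div p ^ i)"
proof -
  let ?T = "\<lambda>i. ((l + 1) * (n mod p ^ i)) div p ^ i"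
  have "?T i + l div p ^ i = l" if "i \<in> {1..j}" for i
  proof -
    have "p ^ i dvd n + 1" using that dvd by (meson atLeastAtMost_iff dvd_trans le_imp_power_dvd)
    then show ?thesis using p Suc_mult_pred_div[of "p ^ i" l] by (simp only: mod_eq_pred_if_dvd_Suc) simp
  qed
  then have "(\<Sum>i=1..j. ?T i + l div p ^ i) = (\<Sum>i=1..j. l)"
    by (intro sum.cong) auto
  then have "l * j = (\<Sum>i=1..j. ?T i) + (\<Sum>i=1..j. l div p ^ i)"
    by (simp only: sum.distrib) (simp add: mult.commute)
  also have "\<dots> \<le> (\<Sum>i=1..j. ?T i) + (\<Sum>i=j+1..N. ?T i)"
    using le by simp
  also have "\<dots> = (\<Sum>i=1..N. ?T i)"
    using sum.ub_add_nat[of 1 j ?T "N - j"] \<open>j \<le> N\<close> by simp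
  finally show ?thesis .
qed

section \<open>Three cases in which the later terms cover the deficit\<close>

lemma deficit_le_if_power_le:
  fixes p j l n :: nat
  assumes p: "p \<ge> 2" and le: "p ^ j \<le> n"
  shows "\<exists>N. (\<Sum>i=1..j. l div p ^ i) \<le> (\<Sum>i=j+1..N. ((l + 1) * (n mod p ^ i)) div p ^ i)"
proof -
  have "1 \<le> n" using p le by (metis le_trans one_le_power one_le_numeral)
  \<comment> \<open>For \<open>i \<ge> 1\<close> the modulus \<open>p ^ (i + e)\<close> exceeds
    \<open>n\<close>, so the remainder is \<open>n\<close> itself, and
    \<open>(l + 1) * n \<ge> l * p ^ e\<close> bounds the term at \<open>i + e\<close> below by
    \<open>l div p ^ i\<close>.\<close>
  then obtain e where e: "p ^ e \<le> n" "n < p ^ (e + 1)"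
    using ex_power_ivl1[OF p] by blast
  have "p ^ j < p ^ (e + 1)" using le e by simp
  then have "j < e + 1" using p by (subst (asm) power_strict_increasing_iff) auto
  have "(\<Sum>i=1..j. l div p ^ i) \<le> (\<Sum>i=1..j. ((l + 1) * (n mod p ^ (i + e))) div p ^ (i + e))"
  proof (rule sum_mono)
    fix i assume i: "i \<in> {1..j}"
    have "p ^ (e + 1) \<le> p ^ (i + e)" using p i by (intro power_increasing) auto
    then have mod: "n mod p ^ (i + e) = n" using e by simp
    have "l div p ^ i = (l * p ^ e) div (p ^ i * p ^ e)"
      using p by simp
    also have "\<dots> \<le> ((l + 1) * n) div (p ^ i * p ^ e)"
      using e by (intro div_le_mono mult_mono) auto
    finally show "l div p ^ i \<le> ((l + 1) * (n mod p ^ (i + e))) div p ^ (i + e)"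
      unfolding mod by (simp only: power_add)
  qed
  also have "\<dots> = (\<Sum>i=1+e..j+e. ((l + 1) * (n mod p ^ i)) div p ^ i)"
    by (rule sum.shift_bounds_cl_nat_ivl[symmetric])
  \<comment> \<open>As \<open>j \<le> e\<close>, the terms from \<open>1 + e\<close> on are among
    those from \<open>j + 1\<close> on.\<close>
  also have "\<dots> \<le> (\<Sum>i=j+1..j+e. ((l + 1) * (n mod p ^ i)) div p ^ i)"
    using \<open>j < e + 1\<close> by (intro sum_mono2) auto
  finally show ?thesis by blast
qed

lemma power_pred_mod_power:
  fixes p i j :: nat
  assumes "p > 0" "j \<le> i"
  shows "(p ^ j - 1) mod p ^ i = p ^ j - 1"
proof -
  have "p ^ j \<le> p ^ i" "0 < p ^ j" using assms by (auto intro: power_increasing)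
  then have "p ^ j - 1 < p ^ i" by linarith
  then show ?thesis by (rule mod_less)
qed

text \<open>For \<open>l < p ^ j\<close>, the number \<open>p ^ j - 1 - l\<close> is a genuine
  remainder modulo \<open>p ^ j\<close>, so dividing \<open>(l + 1) * (p ^ j - 1)\<close> by
  \<open>p ^ j\<close> gives exactly \<open>l\<close>. Dividing further by \<open>p ^ i\<close>
  shows that the term at \<open>i + j\<close> equals \<open>l div p ^ i\<close>.\<close>

lemma deficit_le_if_less_power:
  fixes p j l :: nat
  assumes p: "p > 0" and l: "l < p ^ j"
  shows "\<exists>N. (\<Sum>i=1..j. l div p ^ i) \<le>
    (\<Sum>i=j+1..N. ((l + 1) * ((p ^ j - 1) mod p ^ i)) div p ^ i)"
proof -
  have eq: "(l + 1) * (p ^ j - 1) = (p ^ j - 1 - l) + l * p ^ j"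
    using l by (simp add: algebra_simps diff_mult_distrib2)
  have "((l + 1) * (p ^ j - 1)) div p ^ j = l"
    unfolding eq using l by (intro add_mult_div_eq) linarith
  then have T: "((l + 1) * ((p ^ j - 1) mod p ^ (i + j))) div p ^ (i + j) = l div p ^ i" for i
    using p by (subst power_pred_mod_power) (simp_all only: add.commute[of i j] power_add div_mult2_eq le_add1)
  have "(\<Sum>i=1..j. l div p ^ i) =
      (\<Sum>i=1..j. ((l + 1) * ((p ^ j - 1) mod p ^ (i + j))) div p ^ (i + j))"
    by (simp only: T)
  also have "\<dots> = (\<Sum>i=1+j..j+j. ((l + 1) * ((p ^ j - 1) mod p ^ i)) div p ^ i)"
    by (rule sum.shift_bounds_cl_nat_ivl[symmetric])
  finally show ?thesis by (intro exI[of _ "j+j"]) (simp add: add.commute)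
qed

text \<open>Induction on \<open>k\<close>. Raising \<open>k\<close> by one multiplies the numerators
  by \<open>p ^ j\<close>, which shifts the terms by \<open>j\<close> places and brings in
  \<open>j\<close> new ones at the front. These are differences of consecutive right-hand sides. The
  \<open>+ j\<close> avoids truncated subtraction.\<close>

lemma sum_telescope_power_div:
  fixes a p j k :: nat
  assumes a: "a \<in> {1..p - 1}" and "k \<ge> 1"
  shows "(\<Sum>i=j+1..(k+1)*j. (a * p ^ (k * j) * (p ^ j - 1)) div p ^ i) + j =
    (\<Sum>i=1..j. a * p ^ (k * j - i))"
proof -
  have p: "p > 0" "a < p" "a > 0" using a by auto
  have shift: "(\<Sum>i=j+1..(Suc k+1)*j. (a * p ^ (Suc k * j) * (p ^ j - 1)) div p ^ i) =
      (\<Sum>i=1..(k+1)*j. (a * p ^ (k * j) * (p ^ j - 1)) div p ^ i)" for k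
  proof -
    have "(a * p ^ (Suc k * j) * (p ^ j - 1)) div p ^ (i + j) =
        (a * p ^ (k * j) * (p ^ j - 1)) div p ^ i" for i
    proof -
      have "a * p ^ (Suc k * j) * (p ^ j - 1) = (a * p ^ (k * j) * (p ^ j - 1)) * p ^ j"
        by (simp add: power_add mult_ac)
      then show ?thesis using p by (simp only: power_add) simp
    qed
    then show ?thesis
      using sum.shift_bounds_cl_nat_ivl
        [of "\<lambda>i. (a * p ^ (Suc k * j) * (p ^ j - 1)) div p ^ i" 1 j "(k+1)*j"]
      by (simp add: algebra_simps)
  qed
  show ?thesis using \<open>k \<ge> 1\<close>
  proof (induction k rule: dec_induct)
    case base
    \<comment> \<open>Here \<open>0 < a < p\<close> matters: \<open>a * p ^ j - a\<close> lies less
      than \<open>p ^ i\<close> below the multiple \<open>a * p ^ (j - i) * p ^ i\<close>, so the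
      quotient drops by exactly one.\<close>
    have "(a * (p ^ j - 1)) div p ^ i + 1 = a * p ^ (j - i)" if i: "i \<in> {1..j}" for i
    proof -
      have pj: "p ^ j = p ^ (j - i) * p ^ i" using i by (simp flip: power_add)
      have "p ^ 1 \<le> p ^ i" using p i by (intro power_increasing) auto
      then have api: "a < p ^ i" using p by simp
      have ge: "a * p ^ (j - i) \<ge> 1" using p by (simp add: Suc_leI)
      have "a * (p ^ j - 1) = a * p ^ (j - i) * p ^ i - a"
        by (simp add: pj diff_mult_distrib2 mult_ac)
      also have "a * p ^ (j - i) * p ^ i - a = (p ^ i - a) + (a * p ^ (j - i) - 1) * p ^ i"
      proof -
        obtain c where "a * p ^ (j - i) = Suc c" using ge by (metis Suc_le_D One_nat_def)
        then show ?thesis using api by simp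
      qed
      finally have "a * (p ^ j - 1) = (p ^ i - a) + (a * p ^ (j - i) - 1) * p ^ i" .
      moreover have "p ^ i - a < p ^ i" using p api by simp
      ultimately have "(a * (p ^ j - 1)) div p ^ i = a * p ^ (j - i) - 1"
        by (simp only: add_mult_div_eq)
      then show ?thesis using ge by linarith
    qed
    then have "(\<Sum>i=1..j. (a * (p ^ j - 1)) div p ^ i + 1) = (\<Sum>i=1..j. a * p ^ (j - i))"
      by (intro sum.cong) auto
    \<comment> \<open>\<open>shift\<close> at 0 moves the range \<open>j+1..2j\<close> down to
      \<open>1..j\<close>.\<close>
    then show ?case using shift[of 0] by (simp add: sum.distrib Suc_eq_plus1[symmetric] sum_Suc)
  next
    case (step k)
    let ?f = "\<lambda>i. (a * p ^ (k * j) * (p ^ j - 1)) div p ^ i"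
    \<comment> \<open>Since \<open>i \<le> j \<le> k * j\<close>, the division by
      \<open>p ^ i\<close> is exact.\<close>
    have f: "?f i + a * p ^ (k * j - i) = a * p ^ (Suc k * j - i)" if i: "i \<in> {1..j}" for i
    proof -
      have "i \<le> k * j" using i step(1) by (metis atLeastAtMost_iff le_trans mult_le_mono1 mult_1)
      then have "p ^ (k * j) = p ^ (k * j - i) * p ^ i" by (simp flip: power_add)
      then have "?f i = a * p ^ (k * j - i) * (p ^ j - 1)" using p by (simp add: mult_ac)
      moreover have "p ^ (Suc k * j - i) = p ^ (k * j - i) * p ^ j"
        using \<open>i \<le> k * j\<close> by (simp flip: power_add add: add.commute)
      moreover obtain d where "p ^ j = Suc d" using p by (metis gr0_implies_Suc zero_less_power)
      ultimately show ?thesis by (simp only: diff_Suc_1) (simp add: distrib_left mult.assoc)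
    qed
    have "(\<Sum>i=1..(k+1)*j. ?f i) = (\<Sum>i=1..j. ?f i) + (\<Sum>i=j+1..(k+1)*j. ?f i)"
      using sum.ub_add_nat[of 1 j ?f "k*j"] by (simp add: algebra_simps)
    then have "(\<Sum>i=j+1..(Suc k+1)*j. (a * p ^ (Suc k * j) * (p ^ j - 1)) div p ^ i) + j =
        (\<Sum>i=1..j. ?f i) + (\<Sum>i=1..j. a * p ^ (k * j - i))"
      using shift[of k] step.IH by simp
    also have "\<dots> = (\<Sum>i=1..j. a * p ^ (Suc k * j - i))"
      unfolding sum.distrib[symmetric] using f by (intro sum.cong) auto
    finally show ?case .
  qed
qed

text \<open>For \<open>i \<le> j\<close> the power \<open>p ^ i\<close> divides
  \<open>l + 1\<close>, so \<open>l div p ^ i\<close> is one less than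
  \<open>(l + 1) div p ^ i\<close>. The deficit is thus the right-hand side of the telescoping
  identity minus \<open>j\<close>, and equality holds at \<open>N = (k+1)*j\<close>.\<close>

lemma deficit_le_if_digit_times_power:
  fixes a p j k l :: nat
  assumes a: "a \<in> {1..p - 1}" and "k \<ge> 1" and l: "l = a * p ^ (k * j) - 1"
  shows "\<exists>N. (\<Sum>i=1..j. l div p ^ i) \<le>
    (\<Sum>i=j+1..N. ((l + 1) * ((p ^ j - 1) mod p ^ i)) div p ^ i)"
proof -
  have p: "p > 0" "a > 0" using a by auto
  have l1: "l + 1 = a * p ^ (k * j)" using l p by simp
  have "l div p ^ i + 1 = a * p ^ (k * j - i)" if i: "i \<in> {1..j}" for i
  proof -
    have "i \<le> k * j" using i \<open>k \<ge> 1\<close> by (metis atLeastAtMost_iff le_trans mult_le_mono1 mult_1)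
    then have "p ^ (k * j) = p ^ (k * j - i) * p ^ i" by (simp flip: power_add)
    then have eq: "Suc l = a * p ^ (k * j - i) * p ^ i" using l1 by simp
    then have "Suc l div p ^ i = a * p ^ (k * j - i)" using p by simp
    moreover have "p ^ i dvd Suc l" unfolding eq by simp
    ultimately show ?thesis using p Suc_div_eq_add_indicator[of "p ^ i" l] by simp
  qed
  then have "(\<Sum>i=1..j. l div p ^ i + 1) = (\<Sum>i=1..j. a * p ^ (k * j - i))"
    by (intro sum.cong) auto
  then have "(\<Sum>i=1..j. l div p ^ i) + j = (\<Sum>i=1..j. a * p ^ (k * j - i))"
    by (simp only: sum.distrib) simp
  also have "\<dots> = (\<Sum>i=j+1..(k+1)*j. ((l + 1) * (p ^ j - 1)) div p ^ i) + j"
    unfolding l1 using sum_telescope_power_div[OF a \<open>k \<ge> 1\<close>] by simp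
  also have "(\<Sum>i=j+1..(k+1)*j. ((l + 1) * (p ^ j - 1)) div p ^ i) =
      (\<Sum>i=j+1..(k+1)*j. ((l + 1) * ((p ^ j - 1) mod p ^ i)) div p ^ i)"
    using p by (intro sum.cong refl) (subst power_pred_mod_power, auto)
  finally show ?thesis by (intro exI[of _ "(k+1)*j"]) linarith
qed

section \<open>From valuations to integrality\<close>

lemma multiplicity_denominator_le:
  fixes p l n N :: nat
  assumes p: "prime p"
    and le: "(\<Sum>i=1..multiplicity p (n + 1). l div p ^ i) \<le>
      (\<Sum>i=multiplicity p (n + 1)+1..N. ((l + 1) * (n mod p ^ i)) div p ^ i)"
  shows "multiplicity p ((n + 1) ^ l * fact n ^ (l + 1)) \<le> multiplicity p (fact ((l + 1) * n))"
proof -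
  define j where "j = multiplicity p (n + 1)"
  \<comment> \<open>Large enough for both Legendre sums and for splitting at \<open>j\<close>; extra
    later terms only increase the right-hand side of \<open>le\<close>.\<close>
  define N' where "N' = N + j + (l + 1) * n"
  let ?T = "\<lambda>i. ((l + 1) * (n mod p ^ i)) div p ^ i"
  have "(\<Sum>i=j+1..N. ?T i) \<le> (\<Sum>i=j+1..N'. ?T i)"
    by (intro sum_mono2) (auto simp: N'_def)
  with le have "(\<Sum>i=1..j. l div p ^ i) \<le> (\<Sum>i=j+1..N'. ?T i)"
    unfolding j_def by (rule order_trans)
  then have "l * j \<le> (\<Sum>i=1..N'. ?T i)"
    using p by (intro mult_le_sum_carries) (auto simp: j_def N'_def prime_gt_0_nat multiplicity_dvd)
  moreover have "multiplicity p ((n + 1) ^ l * fact n ^ (l + 1)) =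
      l * j + (l + 1) * multiplicity p (fact n :: nat)"
    unfolding j_def using p
    by (simp only: prime_elem_multiplicity_mult_distrib prime_elem_multiplicity_power_distrib
        prime_imp_prime_elem power_not_zero fact_nonzero add_is_0 one_neq_zero simp_thms not_False_eq_True)
  moreover have "multiplicity p (fact ((l + 1) * n)) =
      (l + 1) * multiplicity p (fact n) + (\<Sum>i=1..N'. ?T i)"
    using p by (intro multiplicity_fact_mult) (auto simp: N'_def)
  ultimately show ?thesis by linarith
qed

lemma C_in_Ints_if_dvd:
  assumes "(n + 1) ^ l * fact n ^ (l + 1) dvd (fact ((l + 1) * n) :: nat)"
  shows "C l n \<in> \<int>"
proof -
  obtain c where c: "fact ((l + 1) * n) = ((n + 1) ^ l * fact n ^ (l + 1)) * c"
    using assms unfolding dvd_def by blast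
  have "fact ((l + 1) * n) = (of_nat (fact ((l + 1) * n)) :: rat)"
    by (rule of_nat_fact[symmetric])
  also have "\<dots> = ((of_nat n + 1) ^ l * fact n ^ (l + 1)) * of_nat c"
    unfolding c by (simp add: add.commute)
  finally have f: "fact ((l + 1) * n) = ((of_nat n + 1) ^ l * fact n ^ (l + 1)) * (of_nat c :: rat)" .
  have "(of_nat n + 1 :: rat) \<noteq> 0"
    by (metis of_nat_Suc of_nat_eq_0_iff nat.simps(3) add.commute)
  then have "C l n = of_nat c"
    unfolding C_def f by (simp add: field_simps)
  then show ?thesis by simp
qed

text \<open>At some prime the denominator has the larger valuation, so no cutoff makes the later
  terms cover the deficit. Each of the three cases above is therefore excluded, and each exclusion
  yields one part of the conclusion.\<close>

lemma C_not_in_Ints_imp_prime_power: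
  assumes "C l n \<notin> \<int>"
  shows "\<exists>p j. prime p \<and> j \<ge> 1 \<and> n = p ^ j - 1 \<and> p ^ j \<le> l \<and>
    (\<forall>k. \<forall>a\<in>{1..p - 1}. k \<ge> 1 \<longrightarrow> l \<noteq> a * p ^ (k * j) - 1)"
proof -
  have "\<not> (n + 1) ^ l * fact n ^ (l + 1) dvd (fact ((l + 1) * n) :: nat)"
    using assms C_in_Ints_if_dvd by blast
  then obtain p where p: "prime p"
    and "\<not> multiplicity p ((n + 1) ^ l * fact n ^ (l + 1)) \<le> multiplicity p (fact ((l + 1) * n) :: nat)"
    using multiplicity_le_imp_dvd[of "(n + 1) ^ l * fact n ^ (l + 1)" "fact ((l + 1) * n) :: nat"]
    by auto
  then have *: "\<nexists>N. (\<Sum>i=1..multiplicity p (n + 1). l div p ^ i) \<le>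
      (\<Sum>i=multiplicity p (n + 1)+1..N. ((l + 1) * (n mod p ^ i)) div p ^ i)"
    using multiplicity_denominator_le by blast
  define j where "j = multiplicity p (n + 1)"
  note * = *[folded j_def]
  have p2: "p \<ge> 2" "p > 0" using p by (auto simp: prime_ge_2_nat prime_gt_0_nat)
  \<comment> \<open>For \<open>j = 0\<close> the deficit is an empty sum.\<close>
  have "j \<ge> 1" using * by (cases j) auto
  moreover have n: "n = p ^ j - 1"
  proof -
    have "p ^ j \<le> n + 1" unfolding j_def by (intro dvd_imp_le multiplicity_dvd) simp
    moreover have "\<not> p ^ j \<le> n" using deficit_le_if_power_le[OF p2(1)] * by blast
    ultimately show ?thesis by simp
  qed
  moreover have "p ^ j \<le> l"
    using deficit_le_if_less_power[OF p2(2)] * unfolding n by (meson not_le)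
  moreover have "l \<noteq> a * p ^ (k * j) - 1" if "a \<in> {1..p - 1}" "k \<ge> 1" for a k
    using deficit_le_if_digit_times_power[OF that] * unfolding n by blast
  ultimately show ?thesis using p by blast
qed

theorem theorem10:
  fixes l :: nat
  assumes "l \<ge> 1"
  shows "finite {n::nat. n \<ge> 1 \<and> C l n \<notin> \<int>} \<and>
    (\<forall>n::nat. n \<ge> 1 \<and> C l n \<notin> \<int> \<longrightarrow>
      (\<exists>(p::nat) (j::nat). prime p \<and> j \<ge> 1 \<and> n = p ^ j - 1 \<and> p ^ j \<le> l \<and>
        (\<forall>k::nat. \<forall>a\<in>{1..p - 1}. k \<ge> 1 \<longrightarrow> l \<noteq> a * p ^ (k * j) - 1)))"
proof
  \<comment> \<open>Finiteness follows from \<open>n = p ^ j - 1\<close> and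
    \<open>p ^ j \<le> l\<close>.\<close>
  have "n \<le> l" if "C l n \<notin> \<int>" for n
    using C_not_in_Ints_imp_prime_power[OF that] by auto
  then have "{n. n \<ge> 1 \<and> C l n \<notin> \<int>} \<subseteq> {..l}" by auto
  then show "finite {n::nat. n \<ge> 1 \<and> C l n \<notin> \<int>}" by (rule finite_subset) simp
qed (use C_not_in_Ints_imp_prime_power in blast)

end
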